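(* Let $f\subset\mathbb R^2$ be a curved triangle (a 2-cell read in a chart) whose three edges $E_1,E_2,E_3$ are parametrised, for $t\in[0,1]$, by $$I_1(t)=(h_1(t),g_1(t)),\quad I_2(t)=(h_2(t),g_2(t)),\quad I_3(t)=(0,t),$$ where $h_i,g_i$ are $C^2$; for $i\in\{1,2\}$, $h_i(0)=0$, $h_i(1)=1$ and $h_i$ is strictly increasing; and $g_1(0)=0$, $g_1(1)=0$, $g_2(0)=1$, $g_2(1)=0$. Let $G_i(x):=g_i(h_i^{-1}(x))$, $i\in\{1,2\}$, and $$J_f(x,y):=\frac1{G_2(x)-G_1(x)}\begin{pmatrix}(y-G_1(x))h_2^{-1}(x)+(G_2(x)-y)h_1^{-1}(x)\\(y-G_1(x))(1-h_2^{-1}(x))\end{pmatrix}.$$ If $J_f$ is a $C^2$-diffeomorphism (from $\overline f$ onto its image in $\mathbb R^2$), then it provides affine compatible local coordinates on $f$: for each $i\in\{1,2,3\}$, the map $J_f\circ I_i:[0,1]\to\mathbb R^2$ is affine.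
   Context: A $C^2$-diffeomorphism $J_f$ from $\overline f$ (a closed 2-cell, read in a chart) onto a subset of $\mathbb R^2$ is said to provide affine compatible local coordinates if, for every edge $E$ of $f$ with its chosen parametrisation $I_E:[0,1]\to\overline E$, the composition $J_f\circ I_E$ is affine. The closed cell $\overline f$ is the region bounded by the three curves $E_1,E_2,E_3$; the edges $E_1$ and $E_2$ meet only at the point $(1,0)$ (so $G_1\ne G_2$ on $[0,1)$). At that vertex, where the denominator in the formula for $J_f$ vanishes, $J_f$ is understood as the continuous extension. *)

theory Defs
  imports "HOL-Analysis.Analysis"
begin

definition C2_on_open :: "'a::real_normed_vector set \<Rightarrow> ('a \<Rightarrow> 'b::real_normed_vector) \<Rightarrow> bool" where
  "C2_on_open U f \<longleftrightarrow> open U \<and>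
     (\<exists>(f' :: 'a \<Rightarrow> 'a \<Rightarrow>\<^sub>L 'b) (f'' :: 'a \<Rightarrow> 'a \<Rightarrow>\<^sub>L 'a \<Rightarrow>\<^sub>L 'b).
        (\<forall>x\<in>U. (f has_derivative blinfun_apply (f' x)) (at x)) \<and>
        (\<forall>x\<in>U. (f' has_derivative blinfun_apply (f'' x)) (at x)) \<and>
        continuous_on U f'')"

text \<open>On a set that need not be open (such as \<open>{0..1}\<close> or a closed cell), being \<open>C\<^sup>2\<close>
  means extending locally to a \<open>C\<^sup>2\<close> map on an open set.\<close>

definition C2_on :: "'a::real_normed_vector set \<Rightarrow> ('a \<Rightarrow> 'b::real_normed_vector) \<Rightarrow> bool" where
  "C2_on S f \<longleftrightarrow>
     (\<forall>x\<in>S. \<exists>U F. x \<in> U \<and> C2_on_open U F \<and> (\<forall>z\<in>S \<inter> U. F z = f z))"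

definition C2_diffeomorphism ::
    "'a::real_normed_vector set \<Rightarrow> 'b::real_normed_vector set \<Rightarrow> ('a \<Rightarrow> 'b) \<Rightarrow> bool" where
  "C2_diffeomorphism S T f \<longleftrightarrow>
     bij_betw f S T \<and> C2_on S f \<and> C2_on T (the_inv_into S f)"

definition affine_on_unit_interval :: "(real \<Rightarrow> 'a::real_vector) \<Rightarrow> bool" where
  "affine_on_unit_interval p \<longleftrightarrow> (\<exists>a b. \<forall>t\<in>{0..1}. p t = a + t *\<^sub>R b)"

text \<open>A cell in the plane is given by the set of the chosen parametrisations of its edges; the
  closed cell is the region they bound, together with the edges.\<close>

definition closed_cell :: "(real \<Rightarrow> real \<times> real) set \<Rightarrow> (real \<times> real) set" where
  "closed_cell Es = (let \<Gamma> = (\<Union>I\<in>Es. path_image I) in \<Gamma> \<union> inside \<Gamma>)"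

definition affine_compatible_coordinates ::
    "(real \<Rightarrow> real \<times> real) set \<Rightarrow> (real \<times> real \<Rightarrow> real \<times> real) \<Rightarrow> bool" where
  "affine_compatible_coordinates Es J \<longleftrightarrow>
     C2_diffeomorphism (closed_cell Es) (J ` closed_cell Es) J \<and>
     (\<forall>I\<in>Es. affine_on_unit_interval (J \<circ> I))"

definition edge_curve :: "(real \<Rightarrow> real) \<Rightarrow> (real \<Rightarrow> real) \<Rightarrow> real \<Rightarrow> real \<times> real" where
  "edge_curve h g t = (h t, g t)"

definition triangle_edges ::
    "(real \<Rightarrow> real) \<Rightarrow> (real \<Rightarrow> real) \<Rightarrow> (real \<Rightarrow> real) \<Rightarrow> (real \<Rightarrow> real) \<Rightarrow>
     (real \<Rightarrow> real \<times> real) set" where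
  "triangle_edges h\<^sub>1 g\<^sub>1 h\<^sub>2 g\<^sub>2 =
     {edge_curve h\<^sub>1 g\<^sub>1, edge_curve h\<^sub>2 g\<^sub>2, edge_curve (\<lambda>t. 0) (\<lambda>t. t)}"

abbreviation inv01 :: "(real \<Rightarrow> real) \<Rightarrow> real \<Rightarrow> real" where
  "inv01 h \<equiv> the_inv_into {0..1} h"

definition edge_graph :: "(real \<Rightarrow> real) \<Rightarrow> (real \<Rightarrow> real) \<Rightarrow> real \<Rightarrow> real" where
  "edge_graph h g x = g (inv01 h x)"

definition triangle_coord_formula ::
    "(real \<Rightarrow> real) \<Rightarrow> (real \<Rightarrow> real) \<Rightarrow> (real \<Rightarrow> real) \<Rightarrow> (real \<Rightarrow> real) \<Rightarrow>
     real \<times> real \<Rightarrow> real \<times> real" where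
  "triangle_coord_formula h\<^sub>1 g\<^sub>1 h\<^sub>2 g\<^sub>2 = (\<lambda>(x, y).
     let G\<^sub>1 = edge_graph h\<^sub>1 g\<^sub>1; G\<^sub>2 = edge_graph h\<^sub>2 g\<^sub>2 in
     (1 / (G\<^sub>2 x - G\<^sub>1 x)) *\<^sub>R
       ((y - G\<^sub>1 x) * inv01 h\<^sub>2 x + (G\<^sub>2 x - y) * inv01 h\<^sub>1 x,
        (y - G\<^sub>1 x) * (1 - inv01 h\<^sub>2 x)))"

text \<open>At the vertex \<open>(1, 0)\<close> the formula has a vanishing denominator, and the map takes the value
  of its continuous extension from the rest of the closed cell. If no continuous extension
  exists, \<^const>\<open>Lim\<close> is unspecified, but then the map is discontinuous on the closed cell
  and hence not a \<open>C\<^sup>2\<close>-diffeomorphism.\<close>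

definition triangle_coord ::
    "(real \<Rightarrow> real) \<Rightarrow> (real \<Rightarrow> real) \<Rightarrow> (real \<Rightarrow> real) \<Rightarrow> (real \<Rightarrow> real) \<Rightarrow>
     real \<times> real \<Rightarrow> real \<times> real" where
  "triangle_coord h\<^sub>1 g\<^sub>1 h\<^sub>2 g\<^sub>2 z =
     (if z = (1, 0)
      then Lim (at (1, 0) within closed_cell (triangle_edges h\<^sub>1 g\<^sub>1 h\<^sub>2 g\<^sub>2))
             (triangle_coord_formula h\<^sub>1 g\<^sub>1 h\<^sub>2 g\<^sub>2)
      else triangle_coord_formula h\<^sub>1 g\<^sub>1 h\<^sub>2 g\<^sub>2 z)"

end

theory Submission
  imports Defs
begin

text \<open>Away from the vertex \<open>(1, 0)\<close> the formula evaluates on the three edges to \<open>(t, 0)\<close>,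
  \<open>(t, 1 - t)\<close> and \<open>(0, t)\<close>. A diffeomorphism is continuous, so the first two identities
  persist at the vertex by letting \<open>t\<close> tend to \<open>1\<close>; nothing needs to be known about the limit
  that defines the map there.\<close>

text \<open>Near each point of \<open>S\<close> some differentiable, hence continuous,
  \<open>F\<close> on an open set agrees with \<open>f\<close> on \<open>S\<close>, also at the
  point itself; so the limit within \<open>S\<close> carries over from \<open>F\<close> to
  \<open>f\<close>.\<close>

lemma C2_on_imp_continuous_on:
  assumes "C2_on S f"
  shows "continuous_on S f"
  unfolding continuous_on_eq_continuous_within
proof
  fix x assume x: "x \<in> S"
  then obtain U F where U: "x \<in> U" "C2_on_open U F" "\<forall>z\<in>S \<inter> U. F z = f z"
    using assms by (auto simp: C2_on_def)
  then have "open U" "isCont F x"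
    by (auto simp: C2_on_open_def intro: has_derivative_continuous)
  then have "continuous (at x within S) F"
    by (simp add: continuous_at_imp_continuous_at_within)
  moreover have "eventually (\<lambda>z. F z = f z) (at x within S)"
    using \<open>open U\<close> U by (auto simp: eventually_at_topological)
  ultimately show "continuous (at x within S) f"
    using x U by (auto simp: continuous_within intro: Lim_transform_eventually)
qed

lemma continuous_on_edge_curve:
  assumes "C2_on {0..1} h" and "C2_on {0..1} g"
  shows "continuous_on {0..1} (edge_curve h g)"
  using assms unfolding edge_curve_def[abs_def]
  by (intro continuous_on_Pair C2_on_imp_continuous_on)

text \<open>The difference is continuous and vanishes on \<open>{0..<1}\<close>, which is dense in
  the closed interval.\<close>

lemma continuous_on_eq_right_endpoint:
  fixes p q :: "real \<Rightarrow> 'a::real_normed_vector"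
  assumes "continuous_on {0..1} p" and "continuous_on {0..1} q"
    and "\<And>t. 0 \<le> t \<Longrightarrow> t < 1 \<Longrightarrow> p t = q t" and "t \<in> {0..1}"
  shows "p t = q t"
proof -
  have "p t - q t = 0"
  proof (rule continuous_constant_on_closure[where S = "{0..<1}"])
    show "continuous_on (closure {0..<1}) (\<lambda>t. p t - q t)"
      using assms(1,2) by (simp add: continuous_on_diff)
  qed (use assms(3,4) in simp_all)
  then show ?thesis by simp
qed

lemma inv01_apply:
  assumes "strict_mono_on {0..1} h" and "t \<in> {0..1}"
  shows "inv01 h (h t) = t"
  using assms by (simp add: the_inv_into_f_f strict_mono_on_imp_inj_on)

lemma edge_graph_apply:
  assumes "strict_mono_on {0..1} h" and "t \<in> {0..1}"
  shows "edge_graph h g (h t) = g t"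
  using assms by (simp add: edge_graph_def inv01_apply)

text \<open>This keeps the denominator of the coordinate formula nonzero to the left of the vertex.
  By the intermediate value theorem both edges pass over \<open>x\<close>; equal heights there would
  make a common point with first coordinate below 1, hence different from
  \<open>(1, 0)\<close>.\<close>

lemma edge_graph_ne:
  assumes h\<^sub>1: "continuous_on {0..1} h\<^sub>1" "h\<^sub>1 0 = 0" "h\<^sub>1 1 = 1" "strict_mono_on {0..1} h\<^sub>1"
    and h\<^sub>2: "continuous_on {0..1} h\<^sub>2" "h\<^sub>2 0 = 0" "h\<^sub>2 1 = 1" "strict_mono_on {0..1} h\<^sub>2"
    and meet: "path_image (edge_curve h\<^sub>1 g\<^sub>1) \<inter> path_image (edge_curve h\<^sub>2 g\<^sub>2) = {(1, 0)}"
    and x: "0 \<le> x" "x < 1"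
  shows "edge_graph h\<^sub>1 g\<^sub>1 x \<noteq> edge_graph h\<^sub>2 g\<^sub>2 x"
proof
  assume eq: "edge_graph h\<^sub>1 g\<^sub>1 x = edge_graph h\<^sub>2 g\<^sub>2 x"
  obtain s where s: "s \<in> {0..1}" "h\<^sub>1 s = x"
    using IVT'[of h\<^sub>1 0 x 1] h\<^sub>1 x by auto
  obtain t where t: "t \<in> {0..1}" "h\<^sub>2 t = x"
    using IVT'[of h\<^sub>2 0 x 1] h\<^sub>2 x by auto
  have "g\<^sub>1 s = g\<^sub>2 t"
    using eq s t h\<^sub>1 h\<^sub>2 by (metis edge_graph_apply)
  then have "edge_curve h\<^sub>1 g\<^sub>1 s = (x, g\<^sub>1 s)" "edge_curve h\<^sub>2 g\<^sub>2 t = (x, g\<^sub>1 s)"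
    using s t by (simp_all add: edge_curve_def)
  then have "(x, g\<^sub>1 s) \<in> path_image (edge_curve h\<^sub>1 g\<^sub>1) \<inter> path_image (edge_curve h\<^sub>2 g\<^sub>2)"
    using s t unfolding path_image_def by (intro IntI) (force intro: rev_image_eqI)+
  with meet x show False by auto
qed

lemma strict_mono_on_01_bounds:
  fixes h :: "real \<Rightarrow> real"
  assumes "strict_mono_on {0..1} h" "h 0 = 0" "h 1 = 1" "0 \<le> t" "t < 1"
  shows "0 \<le> h t" "h t < 1"
  using strict_mono_onD[OF assms(1), of 0 t] strict_mono_onD[OF assms(1), of t 1] assms
  by (cases "t = 0"; simp)+

theorem lemma33:
  fixes h\<^sub>1 g\<^sub>1 h\<^sub>2 g\<^sub>2 :: "real \<Rightarrow> real"
  assumes "C2_on {0..1} h\<^sub>1" and "C2_on {0..1} g\<^sub>1"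
    and "C2_on {0..1} h\<^sub>2" and "C2_on {0..1} g\<^sub>2"
    and "h\<^sub>1 0 = 0" and "h\<^sub>1 1 = 1" and "strict_mono_on {0..1} h\<^sub>1"
    and "h\<^sub>2 0 = 0" and "h\<^sub>2 1 = 1" and "strict_mono_on {0..1} h\<^sub>2"
    and "g\<^sub>1 0 = 0" and "g\<^sub>1 1 = 0"
    and "g\<^sub>2 0 = 1" and "g\<^sub>2 1 = 0"
    and "path_image (edge_curve h\<^sub>1 g\<^sub>1) \<inter> path_image (edge_curve h\<^sub>2 g\<^sub>2) = {(1, 0)}"
    and "C2_diffeomorphism
           (closed_cell (triangle_edges h\<^sub>1 g\<^sub>1 h\<^sub>2 g\<^sub>2))
           (triangle_coord h\<^sub>1 g\<^sub>1 h\<^sub>2 g\<^sub>2 ` closed_cell (triangle_edges h\<^sub>1 g\<^sub>1 h\<^sub>2 g\<^sub>2))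
           (triangle_coord h\<^sub>1 g\<^sub>1 h\<^sub>2 g\<^sub>2)"
  shows "affine_compatible_coordinates
           (triangle_edges h\<^sub>1 g\<^sub>1 h\<^sub>2 g\<^sub>2) (triangle_coord h\<^sub>1 g\<^sub>1 h\<^sub>2 g\<^sub>2)"
proof -
  let ?Es = "triangle_edges h\<^sub>1 g\<^sub>1 h\<^sub>2 g\<^sub>2"
  let ?J = "triangle_coord h\<^sub>1 g\<^sub>1 h\<^sub>2 g\<^sub>2"
  have ch: "continuous_on {0..1} h\<^sub>1" "continuous_on {0..1} h\<^sub>2"
    using assms(1,3) by (auto intro: C2_on_imp_continuous_on)
  have ne: "edge_graph h\<^sub>1 g\<^sub>1 x \<noteq> edge_graph h\<^sub>2 g\<^sub>2 x" if "0 \<le> x" "x < 1" for x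
    using edge_graph_ne[OF ch(1) assms(5-7) ch(2) assms(8-10,15) that] .
  have cJ: "continuous_on (closed_cell ?Es) ?J"
    using assms(16) by (auto simp: C2_diffeomorphism_def intro: C2_on_imp_continuous_on)
  \<comment> \<open>The closed cell contains its boundary curves, so \<open>?J\<close> is continuous
    along each edge.\<close>
  have cJI: "continuous_on {0..1} (?J \<circ> I)" if "I \<in> ?Es" "continuous_on {0..1} I" for I
    using that cJ
    by (intro continuous_on_compose)
      (auto simp: closed_cell_def path_image_def Let_def elim!: continuous_on_subset)
  have E1: "(?J \<circ> edge_curve h\<^sub>1 g\<^sub>1) t = (t, 0)" if "t \<in> {0..1}" for t
  proof (rule continuous_on_eq_right_endpoint[OF _ _ _ that])
    show "continuous_on {0..1} (?J \<circ> edge_curve h\<^sub>1 g\<^sub>1)"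
      by (rule cJI) (simp_all add: triangle_edges_def continuous_on_edge_curve assms)
    \<comment> \<open>Since \<open>h\<^sub>1 t < 1\<close>, the point is not the vertex and the
      formula applies. Here \<open>y\<close> equals \<open>G\<^sub>1 x\<close>: both terms with
      \<open>y - G\<^sub>1 x\<close> vanish, and \<open>G\<^sub>2 x - y\<close> cancels the
      denominator, leaving \<open>inv01 h\<^sub>1 x\<close>, which is \<open>t\<close>.\<close>
    show "(?J \<circ> edge_curve h\<^sub>1 g\<^sub>1) t = (t, 0)" if "0 \<le> t" "t < 1" for t
      using strict_mono_on_01_bounds[OF assms(7,5,6) that] ne[of "h\<^sub>1 t"] that
      by (simp add: triangle_coord_def edge_curve_def triangle_coord_formula_def Let_def
          inv01_apply edge_graph_apply assms)
  qed (intro continuous_intros)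
  have E2: "(?J \<circ> edge_curve h\<^sub>2 g\<^sub>2) t = (t, 1 - t)" if "t \<in> {0..1}" for t
  proof (rule continuous_on_eq_right_endpoint[OF _ _ _ that])
    show "continuous_on {0..1} (?J \<circ> edge_curve h\<^sub>2 g\<^sub>2)"
      by (rule cJI) (simp_all add: triangle_edges_def continuous_on_edge_curve assms)
    \<comment> \<open>Now \<open>y\<close> equals \<open>G\<^sub>2 x\<close>, so it is
      \<open>y - G\<^sub>1 x\<close> that cancels the denominator, and
      \<open>inv01 h\<^sub>2 x\<close> is \<open>t\<close>.\<close>
    show "(?J \<circ> edge_curve h\<^sub>2 g\<^sub>2) t = (t, 1 - t)" if "0 \<le> t" "t < 1" for t
      using strict_mono_on_01_bounds[OF assms(10,8,9) that] ne[of "h\<^sub>2 t"] that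
      by (simp add: triangle_coord_def edge_curve_def triangle_coord_formula_def Let_def
          inv01_apply edge_graph_apply assms)
  qed (intro continuous_intros)
  \<comment> \<open>Here \<open>x = 0\<close> throughout, so the vertex is never met: both inverses
    are 0 and the denominator is \<open>g\<^sub>2 0 - g\<^sub>1 0 = 1\<close>.\<close>
  have E3: "(?J \<circ> edge_curve (\<lambda>t. 0) (\<lambda>t. t)) t = (0, t)" for t
  proof -
    have "inv01 h\<^sub>1 0 = 0" "inv01 h\<^sub>2 0 = 0"
      using inv01_apply[of h\<^sub>1 0] inv01_apply[of h\<^sub>2 0] assms(5,7,8,10) by simp_all
    then show ?thesis
      by (simp add: triangle_coord_def edge_curve_def triangle_coord_formula_def Let_def
          edge_graph_def assms)
  qed
  \<comment> \<open>The witnesses are the initial point and direction vector of each side of the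
    straight triangle with corners \<open>(0, 0)\<close>, \<open>(1, 0)\<close> and
    \<open>(0, 1)\<close>.\<close>
  have "affine_on_unit_interval (?J \<circ> edge_curve h\<^sub>1 g\<^sub>1)"
    unfolding affine_on_unit_interval_def
    by (intro exI[of _ "(0, 0)"] exI[of _ "(1, 0)"]) (use E1 in simp)
  moreover have "affine_on_unit_interval (?J \<circ> edge_curve h\<^sub>2 g\<^sub>2)"
    unfolding affine_on_unit_interval_def
    by (intro exI[of _ "(0, 1)"] exI[of _ "(1, -1)"]) (use E2 in simp)
  moreover have "affine_on_unit_interval (?J \<circ> edge_curve (\<lambda>t. 0) (\<lambda>t. t))"
    unfolding affine_on_unit_interval_def
    by (intro exI[of _ "(0, 0)"] exI[of _ "(0, 1)"]) (use E3 in simp)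
  ultimately show ?thesis
    using assms(16) by (simp add: affine_compatible_coordinates_def triangle_edges_def)
qed

end
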